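(* Suppose the $n$ agents' valuations are drawn i.i.d. from a distribution on $[0,1]$ whose density $f$ is positive and Lipschitz continuous on $[0,1]$. Then the optimal single deadline mechanism's expected max-delay approaches $0$ when the number of agents approaches infinity; that is, $$\lim_{n\to\infty}\ \inf_{d\in[0,1]} E\Bigl[\max\{t_1,\dots,t_n\}\Bigr]=0,$$ where $t_1,\dots,t_n$ are the release times of the $n$ agents under the single deadline mechanism $M(d)$ applied to the (truthfully reported) valuation profile.
   Context: Model. There are $n$ agents and a binary public project of cost $1$ that has value over the time period $[0,1]$. Agent $i$ has valuation $v_i\in[0,1]$. An outcome assigns each agent a release time $t_i\in[0,1]$ (agent $i$ consumes the project during $[t_i,1]$) and a payment $p_i\ge0$; agent $i$'s utility is $v_i(1-t_i)-p_i$. For a vector $x=(x_1,\dots,x_m)$ of nonnegative reals, let $I(x)=1$ if there is $k\in\{1,\dots,m\}$ such that at least $k$ of the entries satisfy $x_j\ge \frac1k$, and $I(x)=0$ otherwise (in particular $I=0$ for the empty vector). If $I(x)=1$ let $K(x)$ be the largest such $k$; if $I(x)=0$ let $K(x)=0$. Single deadline mechanism $M(d)$, $d\in[0,1]$: given the profile $v=(v_1,\dots,v_n)$, let $dv=(dv_1,\dots,dv_n)$ and let $v_{-i}$ be $v$ with the $i$-th entry removed. Let $k=K(dv)$. If $k>0$, the agents with the $k$ highest values receive the non-free part and each pays $\frac1k$; all other agents pay $0$. If $k=0$, no agent receives the non-free part and nobody pays. Agent $i$ receives the free part if and only if $I(dv_{-i})=1$. Agent $i$'s release time is $t_i=0$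 if she receives both parts, $t_i=d$ if she receives only the free part, $t_i=1-d$ if she receives only the non-free part, and $t_i=1$ if she receives neither. *)

theory Defs
  imports "HOL-Probability.Probability"
begin

text \<open>A vector with finitely many entries is a function together with its finite index set A, so
  that removing the i-th entry means passing from A to A - {i}. The set below consists of the
  numbers k of entries that can share the unit cost equally.\<close>

definition affordable_counts :: "nat set \<Rightarrow> (nat \<Rightarrow> real) \<Rightarrow> nat set" where
  "affordable_counts A x = {k \<in> {1..card A}. k \<le> card {j \<in> A. x j \<ge> 1 / real k}}"

definition I_fun :: "nat set \<Rightarrow> (nat \<Rightarrow> real) \<Rightarrow> nat" where
  "I_fun A x = (if \<exists>k. k \<in> affordable_counts A x then 1 else 0)"

definition K_fun :: "nat set \<Rightarrow> (nat \<Rightarrow> real) \<Rightarrow> nat" where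
  "K_fun A x = (if I_fun A x = 1 then Max (affordable_counts A x) else 0)"

text \<open>The agents with the k highest values: those with fewer than k strictly higher values.
  In general a tie at the k-th place could produce more than k agents; lemma
  \<open>card_nonfree_recipients\<close> shows that this does not happen for the k used by the mechanism.\<close>

definition k_highest :: "nat \<Rightarrow> nat \<Rightarrow> (nat \<Rightarrow> real) \<Rightarrow> nat set" where
  "k_highest n k v = {i \<in> {..<n}. card {j \<in> {..<n}. v j > v i} < k}"

definition nonfree_recipients :: "nat \<Rightarrow> real \<Rightarrow> (nat \<Rightarrow> real) \<Rightarrow> nat set" where
  "nonfree_recipients n d v = k_highest n (K_fun {..<n} (\<lambda>j. d * v j)) v"

definition free_recipients :: "nat \<Rightarrow> real \<Rightarrow> (nat \<Rightarrow> real) \<Rightarrow> nat set" where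
  "free_recipients n d v = {i \<in> {..<n}. I_fun ({..<n} - {i}) (\<lambda>j. d * v j) = 1}"

lemma finite_affordable_counts: "finite (affordable_counts A x)"
  unfolding affordable_counts_def by simp

lemma nonfree_recipients_eq:
  assumes "d \<ge> 0" and pos: "K_fun {..<n} (\<lambda>j. d * v j) > 0"
  defines "k \<equiv> K_fun {..<n} (\<lambda>j. d * v j)"
  shows "nonfree_recipients n d v = {i \<in> {..<n}. d * v i \<ge> 1 / real k}"
    and "card (nonfree_recipients n d v) = k"
proof -
  define S where "S = affordable_counts {..<n} (\<lambda>j. d * v j)"
  define T where "T = {i \<in> {..<n}. d * v i \<ge> 1 / real k}"
  have k: "k = Max S" and "S \<noteq> {}"
    using pos unfolding k_def S_def K_fun_def I_fun_def by (auto split: if_splits)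
  then have "k \<in> S" and max: "\<And>l. l \<in> S \<Longrightarrow> l \<le> k"
    using finite_affordable_counts by (auto simp: S_def)
  then have "k \<ge> 1" and ge: "card T \<ge> k"
    unfolding S_def T_def affordable_counts_def by auto
  have fT: "finite T" unfolding T_def by simp
  have cT: "card T = k"
  proof (rule ccontr)
    assume "card T \<noteq> k"
    with ge have less: "Suc k \<le> card T" by simp
    have "1 / real (Suc k) \<le> 1 / real k"
      using \<open>k \<ge> 1\<close> by (intro divide_left_mono) auto
    then have "T \<subseteq> {i \<in> {..<n}. d * v i \<ge> 1 / real (Suc k)}"
      unfolding T_def by fastforce
    then have "card T \<le> card {i \<in> {..<n}. d * v i \<ge> 1 / real (Suc k)}"
      by (intro card_mono) auto
    moreover have "card T \<le> card {..<n}" unfolding T_def by (intro card_mono) auto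
    ultimately have "Suc k \<in> S"
      using less unfolding S_def affordable_counts_def by auto
    with max show False by fastforce
  qed
  have "nonfree_recipients n d v = T"
  proof (intro set_eqI iffI)
    fix i assume i: "i \<in> nonfree_recipients n d v"
    then have "i < n" and c: "card {j \<in> {..<n}. v j > v i} < k"
      unfolding nonfree_recipients_def k_highest_def k_def by auto
    show "i \<in> T"
    proof (rule ccontr)
      assume "i \<notin> T"
      with \<open>i < n\<close> have "d * v i < 1 / real k" unfolding T_def by auto
      then have "T \<subseteq> {j \<in> {..<n}. v j > v i}"
        using \<open>d \<ge> 0\<close> unfolding T_def
        by (auto intro: mult_left_less_imp_less[of d] less_le_trans)
      then have "card T \<le> card {j \<in> {..<n}. v j > v i}" by (intro card_mono) auto
      with c cT show False by simp
    qed
  next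
    fix i assume i: "i \<in> T"
    have "{j \<in> {..<n}. v j > v i} \<subseteq> T - {i}"
    proof
      fix j assume j: "j \<in> {j \<in> {..<n}. v j > v i}"
      then have "d * v i \<le> d * v j" using \<open>d \<ge> 0\<close> by (intro mult_left_mono) auto
      with i j show "j \<in> T - {i}" unfolding T_def by auto
    qed
    then have "card {j \<in> {..<n}. v j > v i} \<le> card (T - {i})"
      using fT by (intro card_mono) auto
    also have "\<dots> < k" using i fT cT \<open>k \<ge> 1\<close> by (simp add: card_Diff_singleton)
    finally show "i \<in> nonfree_recipients n d v"
      using i unfolding nonfree_recipients_def k_highest_def k_def T_def by auto
  qed
  then show "nonfree_recipients n d v = {i \<in> {..<n}. d * v i \<ge> 1 / real k}"
    and "card (nonfree_recipients n d v) = k"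
    using cT by (auto simp: T_def)
qed

lemma card_nonfree_recipients:
  "d \<ge> 0 \<Longrightarrow> card (nonfree_recipients n d v) = K_fun {..<n} (\<lambda>j. d * v j)"
  using nonfree_recipients_eq(2)[of d n v]
  by (cases "K_fun {..<n} (\<lambda>j. d * v j) > 0") (auto simp: nonfree_recipients_def k_highest_def)

text \<open>The outcome of the mechanism for agent i: release time and payment.\<close>

definition single_deadline ::
    "nat \<Rightarrow> real \<Rightarrow> (nat \<Rightarrow> real) \<Rightarrow> nat \<Rightarrow> real \<times> real" where
  "single_deadline n d v i =
    (if i \<in> free_recipients n d v
       then (if i \<in> nonfree_recipients n d v then 0 else d)
       else (if i \<in> nonfree_recipients n d v then 1 - d else 1),
     if i \<in> nonfree_recipients n d v
       then 1 / real (K_fun {..<n} (\<lambda>j. d * v j)) else 0)"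

definition release_time :: "nat \<Rightarrow> real \<Rightarrow> (nat \<Rightarrow> real) \<Rightarrow> nat \<Rightarrow> real" where
  "release_time n d v i = fst (single_deadline n d v i)"

text \<open>Unspecified for n = 0.\<close>

definition max_delay :: "nat \<Rightarrow> real \<Rightarrow> (nat \<Rightarrow> real) \<Rightarrow> real" where
  "max_delay n d v = Max (release_time n d v ` {..<n})"

definition valuation_distr :: "(real \<Rightarrow> real) \<Rightarrow> real measure" where
  "valuation_distr f = density lborel (\<lambda>x. ennreal (f x * indicator {0..1} x))"

text \<open>The law of n valuations drawn independently with density f.\<close>

definition profile_distr :: "(real \<Rightarrow> real) \<Rightarrow> nat \<Rightarrow> (nat \<Rightarrow> real) measure" where
  "profile_distr f n = (\<Pi>\<^sub>M i\<in>{..<n}. valuation_distr f)"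

text \<open>The expected max-delay is a genuine expectation: the integrand is measurable and bounded.\<close>

lemma measurable_card_Collect:
  assumes "finite A" and "\<And>j. j \<in> A \<Longrightarrow> Measurable.pred M (P j)"
  shows "(\<lambda>v. card {j \<in> A. P j v}) \<in> measurable M (count_space UNIV)"
proof -
  have "real (card {j \<in> A. P j v}) = (\<Sum>j\<in>A. if P j v then 1 else 0)" for v
    using sum.inter_filter[OF assms(1), of "\<lambda>_. 1 :: real" "\<lambda>j. P j v"] by simp
  moreover have "(\<lambda>v. \<Sum>j\<in>A. if P j v then 1 else 0 :: real) \<in> borel_measurable M"
  proof (rule borel_measurable_sum)
    fix j assume "j \<in> A"
    then have [measurable]: "Measurable.pred M (P j)" by (rule assms(2))
    show "(\<lambda>v. if P j v then 1 else 0 :: real) \<in> borel_measurable M" by measurable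
  qed
  ultimately have "(\<lambda>v. real (card {j \<in> A. P j v})) \<in> borel_measurable M" by simp
  then have "(\<lambda>v. nat \<lfloor>real (card {j \<in> A. P j v})\<rfloor>) \<in> measurable M (count_space UNIV)"
    by measurable
  then show ?thesis by simp
qed

lemma sets_valuation_distr [simp]: "sets (valuation_distr f) = sets borel"
  by (simp add: valuation_distr_def)

lemma measurable_profile_component:
  "j < n \<Longrightarrow> (\<lambda>v. v j) \<in> borel_measurable (profile_distr f n)"
  using measurable_component_singleton[of j "{..<n}" "\<lambda>_. valuation_distr f"]
  unfolding profile_distr_def by (simp cong: measurable_cong_sets)

lemma pred_affordable:
  assumes "A \<subseteq> {..<n}"
  shows "Measurable.pred (profile_distr f n) (\<lambda>v. k \<in> affordable_counts A (\<lambda>j. d * v j))"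
proof -
  have [simp]: "finite A" using assms finite_subset by blast
  have "Measurable.pred (profile_distr f n) (\<lambda>v. 1 / real k \<le> d * v j)" if "j \<in> A" for j
  proof -
    have [measurable]: "(\<lambda>v. v j) \<in> borel_measurable (profile_distr f n)"
      using that assms measurable_profile_component by blast
    show ?thesis by measurable
  qed
  then have [measurable]: "(\<lambda>v. card {j \<in> A. 1 / real k \<le> d * v j})
      \<in> measurable (profile_distr f n) (count_space UNIV)"
    by (intro measurable_card_Collect) auto
  show ?thesis unfolding affordable_counts_def by measurable
qed

lemma pred_free_recipients:
  "Measurable.pred (profile_distr f n) (\<lambda>v. i \<in> free_recipients n d v)"
proof -
  have [measurable]: "Measurable.pred (profile_distr f n)
      (\<lambda>v. k \<in> affordable_counts ({..<n} - {i}) (\<lambda>j. d * v j))" for k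
    by (intro pred_affordable) auto
  have eq: "(\<lambda>v. i \<in> free_recipients n d v) =
      (\<lambda>v. i < n \<and> (\<exists>k. k \<in> affordable_counts ({..<n} - {i}) (\<lambda>j. d * v j)))"
    by (auto simp: free_recipients_def I_fun_def fun_eq_iff)
  show ?thesis unfolding eq by measurable
qed

lemma pred_nonfree_recipients:
  "Measurable.pred (profile_distr f n) (\<lambda>v. i \<in> nonfree_recipients n d v)"
proof (cases "i < n")
  case True
  have [measurable]: "Measurable.pred (profile_distr f n)
      (\<lambda>v. k \<in> affordable_counts {..<n} (\<lambda>j. d * v j))" for k
    by (intro pred_affordable) auto
  have "Measurable.pred (profile_distr f n) (\<lambda>v. v j > v i)" if "j < n" for j
  proof -
    have [measurable]: "(\<lambda>v. v j) \<in> borel_measurable (profile_distr f n)"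
      "(\<lambda>v. v i) \<in> borel_measurable (profile_distr f n)"
      using that True measurable_profile_component by blast+
    show ?thesis by measurable
  qed
  then have [measurable]: "(\<lambda>v. card {j \<in> {..<n}. v j > v i})
      \<in> measurable (profile_distr f n) (count_space UNIV)"
    by (intro measurable_card_Collect) auto
  have eq: "(\<lambda>v. i \<in> nonfree_recipients n d v) = (\<lambda>v. \<exists>k. k \<in> affordable_counts {..<n} (\<lambda>j. d * v j)
      \<and> card {j \<in> {..<n}. v j > v i} < k)" (is "?L = ?R")
  proof
    fix v
    let ?S = "affordable_counts {..<n} (\<lambda>j. d * v j)"
    let ?c = "card {j \<in> {..<n}. v j > v i}"
    have "?L v \<longleftrightarrow> ?S \<noteq> {} \<and> ?c < Max ?S"
      using True by (auto simp: nonfree_recipients_def k_highest_def K_fun_def I_fun_def)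
    also have "\<dots> \<longleftrightarrow> ?R v"
      using Max_gr_iff[OF finite_affordable_counts[of "{..<n}" "\<lambda>j. d * v j"]] by (cases "?S = {}") auto
    finally show "?L v = ?R v" .
  qed
  show ?thesis unfolding eq by measurable
qed (simp add: nonfree_recipients_def k_highest_def)

lemma measurable_max_delay: "max_delay n d \<in> borel_measurable (profile_distr f n)"
proof -
  have "(\<lambda>v. release_time n d v i) \<in> borel_measurable (profile_distr f n)" for i
  proof -
    note [measurable] = pred_free_recipients pred_nonfree_recipients
    show ?thesis unfolding release_time_def single_deadline_def fst_conv by measurable
  qed
  then have "(\<lambda>v. Max ((\<lambda>i. release_time n d v i) ` {..<n})) \<in> borel_measurable (profile_distr f n)"
    by (intro borel_measurable_Max) auto
  then show ?thesis unfolding max_delay_def .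
qed

lemma max_delay_bounds:
  assumes "d \<in> {0..1}" "n > 0"
  shows "max_delay n d v \<in> {0..1}"
proof -
  have "max_delay n d v \<in> release_time n d v ` {..<n}"
    unfolding max_delay_def using assms by (intro Max_in) auto
  then show ?thesis
    using assms by (auto simp: release_time_def single_deadline_def)
qed

lemma integrable_max_delay:
  assumes "prob_space (valuation_distr f)" "d \<in> {0..1}" "n > 0"
  shows "integrable (profile_distr f n) (max_delay n d)"
proof -
  interpret prob_space "profile_distr f n"
    unfolding profile_distr_def by (intro prob_space_PiM assms)
  show ?thesis
    using max_delay_bounds[OF assms(2,3)] measurable_max_delay
    by (intro integrable_const_bound[where B = 1]) auto
qed

end

theory Submission
  imports Defs
begin

text \<open>Fix a small \<open>d > 0\<close> and some \<open>k \<ge> 2 / d\<close>. As soon as more than \<open>k\<close> agents value the project at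
  least at \<open>1 / 2\<close>, any \<open>k\<close> of them can share the cost of the non-free part, so the free part goes to
  everybody and no delay exceeds \<open>d\<close>. The number \<open>X\<close> of such agents exceeds \<open>k\<close> with probability tending
  to 1, by an exponential Markov bound: the delay is at most \<open>d + 2 ^ k * 2 powr (- X)\<close>, and the
  expectation of \<open>2 powr (- X)\<close> is the \<open>n\<close>-th power of a number less than 1.\<close>

lemma all_free_recipients:
  assumes "d \<ge> 0" "k > 0" "1 / real k \<le> d * c"
    and many: "card {j \<in> {..<n}. c \<le> v j} > k" and "i < n"
  shows "i \<in> free_recipients n d v"
proof -
  let ?A = "{..<n} - {i}"
  let ?H = "{j \<in> {..<n}. c \<le> v j}"
  have sub: "?H - {i} \<subseteq> {j \<in> ?A. d * v j \<ge> 1 / real k}"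
  proof
    fix j assume j: "j \<in> ?H - {i}"
    then have "d * c \<le> d * v j" using \<open>d \<ge> 0\<close> by (intro mult_left_mono) auto
    with j assms(3) show "j \<in> {j \<in> ?A. d * v j \<ge> 1 / real k}" by auto
  qed
  \<comment> \<open>Whether agent \<open>i\<close> gets the free part is decided without her own
    report; more than \<open>k\<close> high values still leave \<open>k\<close> of them after her
    removal.\<close>
  have "k \<le> card (?H - {i})"
    using many diff_card_le_card_Diff[of "{i}" ?H] by simp
  also have "\<dots> \<le> card {j \<in> ?A. d * v j \<ge> 1 / real k}"
    using sub by (intro card_mono) auto
  finally have ge: "k \<le> card {j \<in> ?A. d * v j \<ge> 1 / real k}" .
  also have "\<dots> \<le> card ?A" by (intro card_mono) auto
  finally have "k \<in> affordable_counts ?A (\<lambda>j. d * v j)"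
    using ge \<open>k > 0\<close> unfolding affordable_counts_def by simp
  then show ?thesis
    using \<open>i < n\<close> unfolding free_recipients_def I_fun_def by auto
qed

text \<open>Once everybody receives the free part, the only possible release times are
  \<open>0\<close> and \<open>d\<close>.\<close>

lemma max_delay_le:
  assumes "d \<ge> 0" "k > 0" "1 / real k \<le> d * c"
    and "card {j \<in> {..<n}. c \<le> v j} > k"
  shows "max_delay n d v \<le> d"
proof -
  have "n > 0" using assms(4) by (cases n) auto
  then have "max_delay n d v \<in> release_time n d v ` {..<n}"
    unfolding max_delay_def by (intro Max_in) auto
  then show ?thesis
    using all_free_recipients[OF assms] \<open>d \<ge> 0\<close>
    by (auto simp: release_time_def single_deadline_def)
qed

text \<open>The product is \<open>2 powr (- X)\<close> with one factor per agent, a form whose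
  expectation splits by independence. If \<open>X \<le> k\<close>, the second summand is at least 1,
  so the trivial bound 1 on the delay suffices.\<close>

lemma max_delay_le_exponential:
  assumes "d \<in> {0..1}" "n > 0" "k > 0" "1 / real k \<le> d * c"
  shows "max_delay n d v \<le> d + 2 ^ k * (\<Prod>j<n. if c \<le> v j then 1 / 2 else 1)"
proof (cases "card {j \<in> {..<n}. c \<le> v j} > k")
  case True
  then have "max_delay n d v \<le> d"
    using assms by (intro max_delay_le) auto
  moreover have "0 \<le> (\<Prod>j<n. if c \<le> v j then 1 / 2 else 1 :: real)"
    by (intro prod_nonneg) auto
  ultimately show ?thesis by (simp add: add_increasing2)
next
  case False
  let ?X = "card {j \<in> {..<n}. c \<le> v j}"
  have "max_delay n d v \<le> 1" using max_delay_bounds[OF assms(1,2)] by auto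
  also have "1 \<le> (2::real) ^ k * (1 / 2) ^ ?X"
    using False power_increasing[of ?X k "2::real"] by (simp add: power_one_over field_simps)
  also have "(1 / 2) ^ ?X = (\<Prod>j<n. if c \<le> v j then 1 / 2 else 1 :: real)"
    using prod.inter_filter[of "{..<n}" "\<lambda>_. 1 / 2 :: real" "\<lambda>j. c \<le> v j"] by simp
  finally show ?thesis using assms(1) by (simp add: add_increasing)
qed

lemma (in prob_space) integral_PiM_prod_power:
  fixes g :: "'a \<Rightarrow> real"
  assumes "integrable M g"
  shows "integrable (\<Pi>\<^sub>M j\<in>{..<n}. M) (\<lambda>v. \<Prod>j<n. g (v j))"
    and "(\<integral>v. (\<Prod>j<n. g (v j)) \<partial>(\<Pi>\<^sub>M j\<in>{..<n}. M)) = integral\<^sup>L M g ^ n"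
proof -
  interpret P: product_sigma_finite "\<lambda>_::nat. M"
    by unfold_locales
  show "integrable (\<Pi>\<^sub>M j\<in>{..<n}. M) (\<lambda>v. \<Prod>j<n. g (v j))"
    using assms by (intro P.product_integrable_prod) auto
  show "(\<integral>v. (\<Prod>j<n. g (v j)) \<partial>(\<Pi>\<^sub>M j\<in>{..<n}. M)) = integral\<^sup>L M g ^ n"
    using assms by (subst P.product_integral_prod) auto
qed

text \<open>Measure zero would force the density to vanish almost everywhere on
  \<open>{c..1}\<close>, an interval of positive length on which it is positive.\<close>

lemma valuation_distr_Ici_pos:
  assumes "prob_space (valuation_distr f)"
    and pos: "\<And>x. x \<in> {0..1} \<Longrightarrow> f x > 0" and cont: "continuous_on {0..1} f"
    and c: "0 \<le> c" "c < 1"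
  shows "measure (valuation_distr f) {c..} > 0"
proof -
  interpret prob_space "valuation_distr f" by fact
  \<comment> \<open>Outside the unit interval \<open>f\<close> is arbitrary, so measurability is
    claimed only for its product with the indicator.\<close>
  have [measurable]: "(\<lambda>x. f x * indicator {0..1} x) \<in> borel_measurable borel"
    using borel_measurable_continuous_on_indicator[OF _ cont] by (simp add: mult.commute)
  have "emeasure (valuation_distr f) {c..} \<noteq> 0"
  proof
    assume "emeasure (valuation_distr f) {c..} = 0"
    then have "{c..} \<in> null_sets (valuation_distr f)" by auto
    then have "AE x in lborel. x \<in> {c..} \<longrightarrow> ennreal (f x * indicator {0..1} x) = 0"
      unfolding valuation_distr_def by (subst (asm) null_sets_density_iff) auto
    then have "AE x in lborel. x \<notin> {c..1}"
    proof eventually_elim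
      case (elim x)
      then show ?case using pos[of x] c by (auto simp: ennreal_eq_0_iff)
    qed
    then have "emeasure lborel {c..1} = 0"
      by (subst (asm) AE_iff_measurable[of "{c..1}"]) auto
    then show False using c by simp
  qed
  then show ?thesis by (simp add: emeasure_eq_measure zero_less_measure_iff)
qed

theorem theorem4p1:
  fixes f :: "real \<Rightarrow> real"
  assumes density: "prob_space (valuation_distr f)"
    and positive: "\<And>x. x \<in> {0..1} \<Longrightarrow> f x > 0"
    and lipschitz: "\<exists>L. L-lipschitz_on {0..1} f"
  shows "(\<lambda>n. INF d\<in>{0..1}. integral\<^sup>L (profile_distr f n) (max_delay n d)) \<longlonglongrightarrow> 0"
proof -
  interpret prob_space "valuation_distr f" by fact
  \<comment> \<open>The factor of a single agent in the exponential bound, at threshold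
    \<open>c = 1 / 2\<close>; its expectation \<open>q\<close> is the base of the geometric
    decay.\<close>
  define g :: "real \<Rightarrow> real" where "g x = (if 1 / 2 \<le> x then 1 / 2 else 1)" for x
  define q where "q = integral\<^sup>L (valuation_distr f) g"
  let ?E = "\<lambda>n d. integral\<^sup>L (profile_distr f n) (max_delay n d)"
  have g_eq: "g = (\<lambda>x. 1 - 1 / 2 * indicator {1 / 2..} x)"
    unfolding g_def by (auto simp: fun_eq_iff)
  have int_g: "integrable (valuation_distr f) g"
    unfolding g_eq by (intro Bochner_Integration.integrable_diff integrable_mult_right
      integrable_real_indicator) (auto simp: emeasure_eq_measure)
  have q: "q = 1 - measure (valuation_distr f) {1 / 2..} / 2"
    unfolding q_def g_eq
    by (subst Bochner_Integration.integral_diff) (auto simp: prob_space emeasure_eq_measure)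
  have "measure (valuation_distr f) {1 / 2..} > 0"
    using lipschitz lipschitz_on_continuous_on
    by (intro valuation_distr_Ici_pos density positive) auto
  then have "q < 1" "q \<ge> 0" using q prob_le_1[of "{1 / 2..}"] by linarith+
  \<comment> \<open>Serves twice: it bounds the set below, so that the infimum lies below its
    members, and it bounds the infimum itself by 0.\<close>
  have E_nonneg: "0 \<le> ?E n d" if "n > 0" "d \<in> {0..1}" for n d
    using max_delay_bounds[OF that(2,1)] by (intro Bochner_Integration.integral_nonneg) auto
  have E_le: "?E n d \<le> d + 2 ^ k * q ^ n"
    if "n > 0" "d \<in> {0..1}" "k > 0" "1 / real k \<le> d * (1 / 2)" for n d k
  proof -
    interpret P: prob_space "profile_distr f n"
      unfolding profile_distr_def by (intro prob_space_PiM density)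
    note prod_g = integral_PiM_prod_power[OF int_g, of n, folded profile_distr_def]
    have "?E n d \<le> (\<integral>v. d + 2 ^ k * (\<Prod>j<n. g (v j)) \<partial>profile_distr f n)"
      using max_delay_le_exponential[OF that(2,1,3,4)] prod_g(1) that
      by (intro integral_mono integrable_max_delay density) (auto simp: g_def)
    also have "\<dots> = d + 2 ^ k * q ^ n"
      using prod_g by (simp add: q_def P.prob_space)
    finally show ?thesis .
  qed
  show ?thesis
  proof (rule tendstoI)
    fix e :: real assume "e > 0"
    \<comment> \<open>Half of \<open>e\<close> goes to the deadline and half to the exponential
      term. As \<open>d\<close> and \<open>k\<close> are fixed before \<open>n\<close> grows,
      \<open>2 ^ k\<close> stays constant.\<close>
    define d where "d = min 1 (e / 2)"
    have d: "d > 0" "d \<in> {0..1}" "d \<le> e / 2" using \<open>e > 0\<close> by (auto simp: d_def)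
    \<comment> \<open>Large enough that a value of \<open>1 / 2\<close>, scaled by \<open>d\<close>,
      covers the share \<open>1 / k\<close>.\<close>
    define k where "k = nat \<lceil>2 / d\<rceil>"
    have "2 / d \<le> real k" unfolding k_def by linarith
    moreover from this have "k > 0" using d(1) by (cases k) auto
    ultimately have k: "k > 0" "1 / real k \<le> d * (1 / 2)"
      using d(1) by (auto simp: field_simps)
    have "(\<lambda>n. 2 ^ k * q ^ n) \<longlonglongrightarrow> 0"
      using \<open>q < 1\<close> \<open>q \<ge> 0\<close> by (intro tendsto_mult_right_zero LIMSEQ_power_zero) auto
    then have "\<forall>\<^sub>F n in sequentially. 2 ^ k * q ^ n < e / 2"
      by (rule order_tendstoD(2)) (use \<open>e > 0\<close> in simp)
    \<comment> \<open>Only positive \<open>n\<close> are considered, since the maximum over no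
      agents is unspecified.\<close>
    then show "\<forall>\<^sub>F n in sequentially. dist (INF d\<in>{0..1}. ?E n d) 0 < e"
      using eventually_gt_at_top[of 0]
    proof eventually_elim
      case (elim n)
      have "bdd_below (?E n ` {0..1})"
        using E_nonneg[OF elim(2)] by (intro bdd_belowI[of _ 0]) auto
      then have "(INF d\<in>{0..1}. ?E n d) \<le> ?E n d" using d(2) by (intro cINF_lower)
      also have "\<dots> \<le> d + 2 ^ k * q ^ n" using elim(2) d(2) k by (rule E_le)
      also have "\<dots> < e" using d(3) elim(1) by simp
      finally have "(INF d\<in>{0..1}. ?E n d) < e" .
      moreover have "0 \<le> (INF d\<in>{0..1}. ?E n d)"
        using E_nonneg[OF elim(2)] by (intro cINF_greatest) auto
      ultimately show ?case by simp
    qed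
  qed
qed

end
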